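(* Let $k$ be a positive integer and $d\ge 0$. Every graph with chromatic number at most $k$ and minimum degree $d$ has a bipartite induced subgraph of minimum degree at least $d/(2k)$.
   Context: All graphs are finite and simple. *)

theory Defs
  imports Complex_Main "Graph_Theory.Digraph_Component"
begin

text \<open>
  Finite simple graphs are the locale \<open>graph\<close> (finite symmetric digraphs without loops and
  without parallel arcs): an edge \<open>{u, v}\<close> is the pair of arcs \<open>(u, v)\<close>, \<open>(v, u)\<close>, so the degree
  of a vertex is its out-degree.
\<close>

text \<open>Meaningful for finite graphs with at least one vertex only (\<open>Min {}\<close> is unspecified).\<close>
definition min_degree :: "('a, 'b) pre_digraph \<Rightarrow> nat" where
  "min_degree G = Min (out_degree G ` verts G)"

definition proper_colouring :: "('a, 'b) pre_digraph \<Rightarrow> nat \<Rightarrow> ('a \<Rightarrow> nat) \<Rightarrow> bool" where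
  "proper_colouring G n c \<longleftrightarrow>
     (\<forall>v \<in> verts G. c v < n) \<and> (\<forall>u v. u \<rightarrow>\<^bsub>G\<^esub> v \<longrightarrow> c u \<noteq> c v)"

definition chromatic_number :: "('a, 'b) pre_digraph \<Rightarrow> nat" where
  "chromatic_number G = (LEAST n. \<exists>c. proper_colouring G n c)"

definition bipartite :: "('a, 'b) pre_digraph \<Rightarrow> bool" where
  "bipartite G \<longleftrightarrow> (\<exists>A B. A \<inter> B = {} \<and> A \<union> B = verts G \<and>
     (\<forall>u v. u \<rightarrow>\<^bsub>G\<^esub> v \<longrightarrow> u \<in> A \<and> v \<in> B \<or> u \<in> B \<and> v \<in> A))"

text \<open>The minimum defining the chromatic number is attained for every finite simple graph.\<close>
lemma proper_colouring_chromatic_number: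
  assumes "graph G"
  shows "\<exists>c. proper_colouring G (chromatic_number G) c"
proof -
  interpret graph G by fact
  obtain c :: "'a \<Rightarrow> nat" where c: "bij_betw c (verts G) {0..<card (verts G)}"
    using ex_bij_betw_finite_nat[OF finite_verts] by blast
  have "proper_colouring G (card (verts G)) c"
    unfolding proper_colouring_def
  proof (intro conjI ballI allI impI)
    fix v assume "v \<in> verts G"
    then show "c v < card (verts G)"
      using c by (auto simp: bij_betw_def)
  next
    fix u v assume uv: "u \<rightarrow>\<^bsub>G\<^esub> v"
    then have "u \<noteq> v" "u \<in> verts G" "v \<in> verts G"
      using no_loops by (auto simp: arcs_ends_conv)
    then show "c u \<noteq> c v"
      using c by (auto simp: bij_betw_def inj_on_def)
  qed
  then have "\<exists>c. proper_colouring G (card (verts G)) c" by blast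
  then show ?thesis
    unfolding chromatic_number_def by (rule LeastI)
qed

end

theory Submission
  imports Defs
begin

text \<open>
  Colour \<open>G\<close> with \<open>k\<close> colours. Averaging over all ordered pairs of colour classes yields classes
  whose union \<open>S\<close> is non-empty and spans at least \<open>(d / k) |S|\<close> arcs. A minimal non-empty
  subset of \<open>S\<close> with this density has minimum degree at least \<open>d / (2 k)\<close>, since deleting a vertex
  of smaller degree would preserve the density.
\<close>

text \<open>Since \<open>R\<close> is symmetric, each edge is counted as two ordered pairs, which
  explains the factor 2 in the density hypothesis. A vertex with fewer than \<open>t\<close>
  neighbours in \<open>S\<close> lies on fewer than \<open>2 * t\<close> of these pairs, so its
  removal preserves the hypothesis and induction over proper subsets applies.\<close>

lemma dense_imp_high_degree_subset:
  fixes R :: "('a \<times> 'a) set" and t :: real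
  assumes "finite S" "S \<noteq> {}" "sym R" "irrefl R"
    and "real (card (R \<inter> S \<times> S)) \<ge> 2 * t * real (card S)"
  shows "\<exists>T \<subseteq> S. T \<noteq> {} \<and> (\<forall>v \<in> T. real (card {w \<in> T. (v, w) \<in> R}) \<ge> t)"
  using assms(1,2,5)
proof (induction S rule: finite_psubset_induct)
  case (psubset S)
  show ?case
  proof (cases "\<forall>v \<in> S. real (card {w \<in> S. (v, w) \<in> R}) \<ge> t")
    case True
    then show ?thesis using psubset.prems by blast
  next
    case False
    then obtain v where v: "v \<in> S" "real (card {w \<in> S. (v, w) \<in> R}) < t"
      by force
    define N where "N = {w \<in> S. (v, w) \<in> R}"
    define S' where "S' = S - {v}"
    have fin: "finite N" "finite S'"
      using psubset.hyps by (auto simp: N_def S'_def)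
    have N: "v \<notin> N" "N \<subseteq> S'"
      using \<open>irrefl R\<close> by (auto simp: N_def S'_def irrefl_def)
    \<comment> \<open>The pairs lost with \<open>v\<close> are those leaving it and those entering
      it. By symmetry both kinds are indexed by \<open>N\<close>, and there is no loop at
      \<open>v\<close>.\<close>
    have "R \<inter> S \<times> S = (R \<inter> S' \<times> S') \<union> (Pair v ` N \<union> (\<lambda>w. (w, v)) ` N)"
      using v(1) \<open>sym R\<close> \<open>irrefl R\<close> by (auto simp: N_def S'_def sym_def irrefl_def)
    then have "card (R \<inter> S \<times> S) \<le>
        card (R \<inter> S' \<times> S') + (card (Pair v ` N) + card ((\<lambda>w. (w, v)) ` N))"
      by (simp only: order_trans[OF card_Un_le add_left_mono[OF card_Un_le]])
    also have "\<dots> \<le> card (R \<inter> S' \<times> S') + (card N + card N)"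
      using fin by (intro add_mono card_image_le) auto
    finally have le: "card (R \<inter> S \<times> S) \<le> card (R \<inter> S' \<times> S') + 2 * card N"
      by simp
    have cS: "real (card S) = real (card S') + 1"
      using card.remove[OF psubset.hyps v(1)] by (simp add: S'_def)
    have dense: "real (card (R \<inter> S' \<times> S')) > 2 * t * real (card S')"
    proof -
      have "2 * t * real (card S') + 2 * t \<le> real (card (R \<inter> S \<times> S))"
        using psubset.prems(2) by (simp add: cS algebra_simps)
      then show ?thesis
        using le v(2) unfolding N_def[symmetric] by linarith
    qed
    \<comment> \<open>Strictness of \<open>dense\<close> matters here: for empty \<open>S'\<close>
      both sides would be 0.\<close>
    moreover have "S' \<noteq> {}"
      using dense by auto
    ultimately obtain T where "T \<subseteq> S'" "T \<noteq> {}"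
      "\<forall>v \<in> T. real (card {w \<in> T. (v, w) \<in> R}) \<ge> t"
      using psubset.IH[of S'] v(1) by (auto simp: S'_def)
    then show ?thesis by (auto simp: S'_def)
  qed
qed

text \<open>If all non-empty unions of two classes were too sparse, the bounds could be summed over
  all \<open>k * k\<close> ordered pairs of colours, diagonal included. Each arc is counted in one
  \<open>E i j\<close>, each vertex \<open>k\<close> times in \<open>P i\<close> and
  \<open>k\<close> times in \<open>P j\<close>, so \<open>2 * card R\<close> would be less than
  \<open>d / k * 2 * k * card V\<close>.\<close>

lemma dense_pair_of_colour_classes:
  fixes R :: "('a \<times> 'a) set" and c :: "'a \<Rightarrow> nat" and d :: real
  assumes "finite V" "V \<noteq> {}" "R \<subseteq> V \<times> V" "sym R" "k > 0"
    and col: "\<And>v. v \<in> V \<Longrightarrow> c v < k" "\<And>u v. (u, v) \<in> R \<Longrightarrow> c u \<noteq> c v"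
    and "real (card R) \<ge> d * real (card V)"
  shows "\<exists>i j. \<exists>S. S = {v \<in> V. c v = i \<or> c v = j} \<and> S \<noteq> {} \<and>
    real (card (R \<inter> S \<times> S)) \<ge> d / real k * real (card S)"
proof (rule ccontr)
  define P where "P i = {v \<in> V. c v = i}" for i
  define E where "E i j = {x \<in> R. (c (fst x), c (snd x)) = (i, j)}" for i j
  define t where "t = d / real k"
  assume "\<not> ?thesis"
  moreover have "P i \<union> P j = {v \<in> V. c v = i \<or> c v = j}" for i j
    by (auto simp: P_def)
  ultimately have sparse:
    "real (card (R \<inter> (P i \<union> P j) \<times> (P i \<union> P j))) < t * real (card (P i \<union> P j))"
    if "P i \<union> P j \<noteq> {}" for i j
    using that unfolding t_def by (metis not_le)
  have finR: "finite R"
    using assms(1,3) finite_subset by blast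
  \<comment> \<open>For \<open>i \<noteq> j\<close> the reversed arcs of \<open>E i j\<close> run
    from class \<open>j\<close> to class \<open>i\<close>, so they form a disjoint copy inside the
    same union. On the diagonal a proper colouring leaves no arcs.\<close>
  have E_card: "2 * card (E i j) \<le> card (R \<inter> (P i \<union> P j) \<times> (P i \<union> P j))" for i j
  proof (cases "i = j")
    case True
    then have "E i j = {}" using col(2) by (force simp: E_def)
    then show ?thesis by simp
  next
    case False
    have "card (E i j) = card (prod.swap ` E i j)"
      by (rule card_image[symmetric]) (auto simp: inj_on_def)
    moreover have "E i j \<inter> prod.swap ` E i j = {}"
      using False by (auto simp: E_def)
    moreover have fE: "finite (E i j)"
      using finR by (simp add: E_def)
    ultimately have "2 * card (E i j) = card (E i j \<union> prod.swap ` E i j)"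
      by (simp add: card_Un_disjoint)
    also have "\<dots> \<le> card (R \<inter> (P i \<union> P j) \<times> (P i \<union> P j))"
      using finR assms(3) \<open>sym R\<close> by (intro card_mono) (auto simp: E_def P_def sym_def)
    finally show ?thesis .
  qed
  have E_less: "2 * real (card (E i j)) < t * real (card (P i) + card (P j))"
    if "P i \<union> P j \<noteq> {}" for i j
  proof -
    have lt: "2 * real (card (E i j)) < t * real (card (P i \<union> P j))"
      using E_card[of i j] sparse[OF that] by linarith
    \<comment> \<open>A cardinality lies strictly below this product, so \<open>t\<close> cannot be
      negative. Hence the size of the union may be replaced by the sum of the two sizes, which is
      larger when \<open>i = j\<close> and the class is non-empty.\<close>
    then have "t * real (card (P i \<union> P j)) > 0"
      by (meson le_less_trans mult_nonneg_nonneg of_nat_0_le_iff zero_le_numeral)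
    then have "t \<ge> 0" by (simp add: zero_less_mult_iff)
    have "t * real (card (P i \<union> P j)) \<le> t * real (card (P i) + card (P j))"
      using \<open>t \<ge> 0\<close> card_Un_le by (intro mult_left_mono) (simp_all del: of_nat_add)
    with lt show ?thesis by linarith
  qed
  \<comment> \<open>Two empty classes are not covered by \<open>sparse\<close>. There both sides are
    0, so only the weak inequality holds for all pairs.\<close>
  have E_le: "2 * real (card (E i j)) \<le> t * real (card (P i) + card (P j))" for i j
  proof (cases "P i \<union> P j = {}")
    case True
    then have "E i j = {}" using assms(3) by (auto simp: E_def P_def)
    then show ?thesis using True by simp
  qed (blast intro: less_imp_le E_less)
  obtain v where v: "v \<in> V" using \<open>V \<noteq> {}\<close> by blast
  let ?K = "{..<k} \<times> {..<k}"
  have "card R = (\<Sum>(i,j) \<in> ?K. card (E i j))"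
  proof -
    have "(\<Sum>p \<in> ?K. \<Sum>x \<in> {x \<in> R. (c (fst x), c (snd x)) = p}. 1::nat) = (\<Sum>x \<in> R. 1)"
      using finR assms(3) col(1) by (intro sum.group) auto
    then show ?thesis by (simp add: E_def case_prod_beta prod_eq_iff)
  qed
  then have "2 * real (card R) = (\<Sum>(i,j) \<in> ?K. 2 * real (card (E i j)))"
    by (simp add: sum_distrib_left case_prod_beta)
  also have "\<dots> < (\<Sum>(i,j) \<in> ?K. t * real (card (P i) + card (P j)))"
  proof (rule sum_strict_mono_ex1)
    \<comment> \<open>The class containing \<open>v\<close> is non-empty, so its diagonal pair
      supplies the one strict inequality that makes the whole sum strict.\<close>
    show "\<exists>p \<in> ?K. (case p of (i, j) \<Rightarrow> 2 * real (card (E i j))) <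
        (case p of (i, j) \<Rightarrow> t * real (card (P i) + card (P j)))"
      using v col(1)[OF v] E_less[of "c v" "c v"]
      by (intro bexI[of _ "(c v, c v)"]) (auto simp: P_def)
  qed (use E_le in auto)
  also have "\<dots> = t * real (\<Sum>i<k. \<Sum>j<k. card (P i) + card (P j))"
    by (simp add: sum.cartesian_product sum_distrib_left case_prod_beta)
  also have "(\<Sum>i<k. \<Sum>j<k. card (P i) + card (P j)) = 2 * k * (\<Sum>i<k. card (P i))"
    by (simp add: sum.distrib flip: sum_distrib_left)
  also have "(\<Sum>i<k. card (P i)) = card V"
  proof -
    have "(\<Sum>i<k. \<Sum>x \<in> {x \<in> V. c x = i}. 1::nat) = (\<Sum>x \<in> V. 1)"
      using assms(1) col(1) by (intro sum.group) auto
    then show ?thesis by (simp add: P_def)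
  qed
  also have "t * real (2 * k * card V) = 2 * (d * real (card V))"
    using \<open>k > 0\<close> by (simp add: t_def)
  finally show False using assms by linarith
qed

text \<open>Out-degree counts arcs; without parallel arcs, \<open>head G\<close> is injective on the
  arcs leaving \<open>v\<close>. Stated for digraphs, this serves both the graph and its induced
  subgraph.\<close>

lemma (in digraph) out_degree_eq_card_neighbours:
  "out_degree G v = card {w. v \<rightarrow>\<^bsub>G\<^esub> w}"
proof -
  have "bij_betw (head G) (out_arcs G v) {w. v \<rightarrow>\<^bsub>G\<^esub> w}"
    using no_multi_arcs
    by (auto simp: bij_betw_def inj_on_def out_arcs_def arcs_ends_conv arc_to_ends_def image_iff)
  then show ?thesis
    by (simp add: out_degree_def bij_betw_same_card)
qed

theorem theorem1p7:
  fixes G :: "('a, 'b) pre_digraph" and k :: nat and d :: real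
  assumes "k > 0"
    and "d \<ge> 0"
    and "graph G"
    and "verts G \<noteq> {}"
    and "chromatic_number G \<le> k"
    and "real (min_degree G) = d"
  shows "\<exists>H. induced_subgraph H G \<and> verts H \<noteq> {} \<and> bipartite H
            \<and> real (min_degree H) \<ge> d / (2 * real k)"
proof -
  interpret graph G by fact
  obtain c where c: "proper_colouring G (chromatic_number G) c"
    using proper_colouring_chromatic_number[OF \<open>graph G\<close>] by blast
  define R where "R = arcs_ends G"
  have R: "R \<subseteq> verts G \<times> verts G" "sym R" "irrefl R"
    using no_loops sym_arcs by (auto simp: R_def irrefl_def arcs_ends_conv symmetric_def)
  \<comment> \<open>The number of arcs is the sum of the out-degrees, each at least
    \<open>d\<close>.\<close>
  have "d * real (card (verts G)) \<le> real (card R)"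
  proof -
    have "R = (SIGMA v : verts G. {w. v \<rightarrow>\<^bsub>G\<^esub> w})"
      using R(1) by (auto simp: R_def)
    moreover have "finite {w. v \<rightarrow>\<^bsub>G\<^esub> w}" for v
      using R(1) by (intro finite_subset[OF _ finite_verts]) (auto simp: R_def)
    ultimately have "card R = (\<Sum>v \<in> verts G. out_degree G v)"
      by (simp add: out_degree_eq_card_neighbours)
    also have "\<dots> \<ge> card (verts G) * min_degree G"
      by (rule sum_bounded_below[of _ "min_degree G", simplified]) (simp add: min_degree_def)
    finally show ?thesis using assms(6)
      by (metis mult.commute of_nat_le_iff of_nat_mult)
  qed
  moreover have "\<And>v. v \<in> verts G \<Longrightarrow> c v < k" "\<And>u v. (u, v) \<in> R \<Longrightarrow> c u \<noteq> c v"
    using c assms(5) by (auto simp: proper_colouring_def R_def)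
  ultimately obtain i j S where S: "S = {v \<in> verts G. c v = i \<or> c v = j}" "S \<noteq> {}"
    and dense: "real (card (R \<inter> S \<times> S)) \<ge> d / real k * real (card S)"
    using dense_pair_of_colour_classes[of "verts G" R k c d] R(1,2) assms(1,4) by auto
  \<comment> \<open>The threshold is half of the density \<open>d / real k\<close>, as
    \<open>2 * t\<close> is the density required.\<close>
  obtain T where T: "T \<subseteq> S" "T \<noteq> {}"
    and deg: "\<And>v. v \<in> T \<Longrightarrow> real (card {w \<in> T. (v, w) \<in> R}) \<ge> d / (2 * real k)"
    using dense_imp_high_degree_subset[of S R "d / (2 * real k)"] S dense R by auto
  define H where "H = G \<restriction> T"
  have TV: "T \<subseteq> verts G" using T S by auto
  then have ind: "induced_subgraph H G"
    by (simp add: H_def induced_induce)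
  interpret H: digraph H
    using ind by (rule digraphI_induced)
  have verts_H: "verts H = T" by (simp add: H_def)
  have arcs_H: "u \<rightarrow>\<^bsub>H\<^esub> v \<longleftrightarrow> u \<in> T \<and> v \<in> T \<and> (u, v) \<in> R" for u v
    by (auto simp: H_def R_def arcs_ends_conv)
  have "bipartite H"
    unfolding bipartite_def
  proof (intro exI conjI allI impI)
    \<comment> \<open>Inside \<open>T\<close> a colour other than \<open>i\<close> must be
      \<open>j\<close>. If \<open>i = j\<close>, the second side is empty and \<open>H\<close> has
      no arcs.\<close>
    show "{v \<in> T. c v = i} \<inter> {v \<in> T. c v \<noteq> i} = {}"
      "{v \<in> T. c v = i} \<union> {v \<in> T. c v \<noteq> i} = verts H"
      by (auto simp: verts_H)
    fix u v assume "u \<rightarrow>\<^bsub>H\<^esub> v"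
    then have "u \<in> T" "v \<in> T" "c u \<noteq> c v"
      using c by (auto simp: arcs_H R_def proper_colouring_def)
    then show "u \<in> {v \<in> T. c v = i} \<and> v \<in> {v \<in> T. c v \<noteq> i} \<or>
        u \<in> {v \<in> T. c v \<noteq> i} \<and> v \<in> {v \<in> T. c v = i}"
      using T(1) S(1) by auto
  qed
  moreover have "real (min_degree H) \<ge> d / (2 * real k)"
  proof -
    have "min_degree H \<in> out_degree H ` verts H"
      unfolding min_degree_def using T(2) by (intro Min_in) (auto simp: verts_H[symmetric])
    then obtain v where "v \<in> T" "min_degree H = out_degree H v"
      by (auto simp: verts_H)
    moreover have "{w. v \<rightarrow>\<^bsub>H\<^esub> w} = {w \<in> T. (v, w) \<in> R}"
      using \<open>v \<in> T\<close> by (auto simp: arcs_H)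
    ultimately show ?thesis
      using deg by (simp add: H.out_degree_eq_card_neighbours)
  qed
  ultimately show ?thesis
    using ind T(2) verts_H by blast
qed

end
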